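(* If $H$ is a fixer, then $H$ is a linear forest on at most $9$ vertices.
   Context: All graphs are finite and simple. A graph is $H$-free if it has no induced subgraph isomorphic to $H$. A vertex $v$ of a graph $G$ is a Gallai vertex if every longest path in $G$ contains $v$. A graph $H$ is called a fixer if every connected $H$-free graph $G$ has a Gallai vertex (equivalently, the minimum size of a set of vertices meeting every longest path of $G$ equals $1$). A linear forest is a forest in which every component is a path (single vertices are allowed as components). *)

theory Defs
  imports Main
begin

record 'a sgraph =
  gverts :: "'a set"
  gedges :: "'a set set"

definition simple_graph :: "'a sgraph \<Rightarrow> bool" where
  "simple_graph G \<longleftrightarrow>
     finite (gverts G) \<and> (\<forall>e\<in>gedges G. e \<subseteq> gverts G \<and> card e = 2)"

definition gadj :: "'a sgraph \<Rightarrow> 'a \<Rightarrow> 'a \<Rightarrow> bool" where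
  "gadj G u v \<longleftrightarrow> {u, v} \<in> gedges G"

definition induced_on :: "'a sgraph \<Rightarrow> 'a set \<Rightarrow> 'a sgraph" where
  "induced_on G S = \<lparr>gverts = S, gedges = {e \<in> gedges G. e \<subseteq> S}\<rparr>"

definition graph_isomorphic :: "'a sgraph \<Rightarrow> 'b sgraph \<Rightarrow> bool" where
  "graph_isomorphic G H \<longleftrightarrow>
     (\<exists>f. bij_betw f (gverts G) (gverts H) \<and>
          (\<forall>u\<in>gverts G. \<forall>v\<in>gverts G. gadj G u v \<longleftrightarrow> gadj H (f u) (f v)))"

definition induced_free :: "'a sgraph \<Rightarrow> 'b sgraph \<Rightarrow> bool" where
  "induced_free H G \<longleftrightarrow>
     \<not> (\<exists>S \<subseteq> gverts G. graph_isomorphic H (induced_on G S))"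

text \<open>Paths are given by their (nonempty) sequence of vertices, so the length of the
  list is the number of edges plus one.\<close>

definition graph_path :: "'a sgraph \<Rightarrow> 'a list \<Rightarrow> bool" where
  "graph_path G p \<longleftrightarrow>
     p \<noteq> [] \<and> set p \<subseteq> gverts G \<and> distinct p \<and> successively (gadj G) p"

definition longest_path :: "'a sgraph \<Rightarrow> 'a list \<Rightarrow> bool" where
  "longest_path G p \<longleftrightarrow>
     graph_path G p \<and> (\<forall>q. graph_path G q \<longrightarrow> length q \<le> length p)"

text \<open>The graph without vertices is not connected; it has no vertex at all, so otherwise
  the definition of a fixer below would degenerate.\<close>

definition graph_connected :: "'a sgraph \<Rightarrow> bool" where
  "graph_connected G \<longleftrightarrow>
     gverts G \<noteq> {} \<and>
     (\<forall>u\<in>gverts G. \<forall>v\<in>gverts G. \<exists>p. graph_path G p \<and> hd p = u \<and> last p = v)"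

definition gallai_vertex :: "'a sgraph \<Rightarrow> 'a \<Rightarrow> bool" where
  "gallai_vertex G v \<longleftrightarrow> v \<in> gverts G \<and> (\<forall>p. longest_path G p \<longrightarrow> v \<in> set p)"

text \<open>Every finite graph is isomorphic to one whose vertices are natural numbers, so
  quantifying over graphs on \<^typ>\<open>nat\<close> covers all finite graphs up to isomorphism,
  whatever the vertex type of \<open>H\<close>.\<close>

definition fixer :: "'a sgraph \<Rightarrow> bool" where
  "fixer H \<longleftrightarrow>
     (\<forall>G :: nat sgraph. simple_graph G \<and> graph_connected G \<and> induced_free H G \<longrightarrow>
        (\<exists>v. gallai_vertex G v))"

definition graph_cycle :: "'a sgraph \<Rightarrow> 'a list \<Rightarrow> bool" where
  "graph_cycle G c \<longleftrightarrow> graph_path G c \<and> 3 \<le> length c \<and> gadj G (last c) (hd c)"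

definition forest :: "'a sgraph \<Rightarrow> bool" where
  "forest G \<longleftrightarrow> \<not> (\<exists>c. graph_cycle G c)"

text \<open>A component is represented by its vertex set \<open>C\<close>; as a graph it is
  \<open>induced_on G C\<close>.\<close>

definition graph_component :: "'a sgraph \<Rightarrow> 'a set \<Rightarrow> bool" where
  "graph_component G C \<longleftrightarrow>
     C \<subseteq> gverts G \<and> graph_connected (induced_on G C) \<and>
     (\<forall>D. C \<subseteq> D \<and> D \<subseteq> gverts G \<and> graph_connected (induced_on G D) \<longrightarrow> D = C)"

definition path_graph :: "nat \<Rightarrow> nat sgraph" where
  "path_graph n = \<lparr>gverts = {..<n}, gedges = {{i, Suc i} | i. Suc i < n}\<rparr>"

definition linear_forest :: "'a sgraph \<Rightarrow> bool" where
  "linear_forest G \<longleftrightarrow>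
     forest G \<and>
     (\<forall>C. graph_component G C \<longrightarrow>
        (\<exists>n\<ge>1. graph_isomorphic (path_graph n) (induced_on G C)))"

end

theory Submission
  imports Defs
begin

text \<open>If a connected graph \<open>G\<close> has no Gallai vertex, then a fixer \<open>H\<close> must be an induced subgraph of
  \<open>G\<close>, for otherwise \<open>G\<close> would be a connected \<open>H\<close>-free graph without a Gallai vertex. Two such
  graphs are enough to pin \<open>H\<close> down.

  The first, \<open>W\<close>, is the Petersen graph in which one vertex has been split into three leaves: it has
  nine cubic vertices and three leaves. The second, \<open>T\<close>, arises from \<open>W\<close> by blowing up every vertex
  into a triangle, each corner of which receives at most one of the edges at the old vertex.
  Neither has a Gallai vertex. A path in either graph projects to a trail in \<open>W\<close>, and a trail in
  \<open>W\<close> visits at most ten of the twelve vertices (\<open>lazy_trail_visits_le_10\<close>): an eleven-vertex trail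
  would run from leaf to leaf through all cubic vertices, and closing it up would give a Hamiltonian
  cycle of the Petersen graph. Hence paths have at most 10 vertices in \<open>W\<close> and at most 30 in \<open>T\<close>.
  Since the Petersen graph minus any vertex is Hamiltonian, both bounds are attained by paths that
  avoid any prescribed vertex.

  So \<open>H\<close> embeds in both graphs. From \<open>W\<close> it inherits the absence of triangles and from \<open>T\<close> the absence
  of induced claws; together these say that its maximum degree is at most 2. Deleting only two
  vertices from \<open>W\<close> leaves some cubic vertex with all its neighbours, so \<open>H\<close> has at most 9 vertices
  (\<open>max_degree_2_in_walther\<close>). No three vertices of a cycle of \<open>H\<close> form a triangle in \<open>T\<close>, so it alternates between edges
  inside triangles and edges of \<open>W\<close> and therefore projects to a closed walk of half its length in
  \<open>W\<close>. As \<open>W\<close> has girth 5, the cycle has at least 10 vertices (\<open>truncated_closed_walk_length\<close>), too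
  many for \<open>H\<close>. A forest of maximum degree 2 is a linear forest (\<open>component_path\<close>).\<close>

section \<open>Graphs on an initial segment of the natural numbers\<close>

definition graph_on :: "nat \<Rightarrow> (nat \<Rightarrow> nat \<Rightarrow> bool) \<Rightarrow> nat sgraph" where
  "graph_on n adj = \<lparr>gverts = {..<n}, gedges = {{x, y} | x y. x < n \<and> y < n \<and> x \<noteq> y \<and> adj x y}\<rparr>"

lemma gverts_graph_on [simp]: "gverts (graph_on n adj) = {..<n}"
  by (simp add: graph_on_def)

lemma simple_graph_on: "simple_graph (graph_on n adj)"
  by (auto simp: graph_on_def simple_graph_def)

lemma gadj_graph_on:
  assumes "\<And>x y. x < n \<Longrightarrow> y < n \<Longrightarrow> adj x y \<Longrightarrow> adj y x"
  shows "gadj (graph_on n adj) x y \<longleftrightarrow> x < n \<and> y < n \<and> x \<noteq> y \<and> adj x y"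
  using assms by (auto simp: graph_on_def gadj_def doubleton_eq_iff)

lemma gadj_sym: "gadj G x y \<longleftrightarrow> gadj G y x"
  by (simp add: gadj_def insert_commute)

lemma gadj_simple:
  assumes "simple_graph G" "gadj G x y"
  shows "x \<in> gverts G" "y \<in> gverts G" "x \<noteq> y"
  using assms unfolding simple_graph_def gadj_def by fastforce+

lemma walk_imp_path:
  assumes "simple_graph G" "u \<in> gverts G" "(gadj G)\<^sup>*\<^sup>* u v"
  shows "\<exists>p. graph_path G p \<and> hd p = u \<and> last p = v"
  using assms(3)
proof (induction rule: rtranclp_induct)
  case base
  have "graph_path G [u]" using assms(2) by (simp add: graph_path_def)
  then show ?case by force
next
  case (step x y)
  then obtain p where p: "graph_path G p" "hd p = u" "last p = x" by blast
  have y: "y \<in> gverts G" using step.hyps gadj_simple[OF assms(1)] by blast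
  show ?case
  proof (cases "y \<in> set p")
    case True
    then obtain a b where ab: "p = a @ y # b" by (meson split_list)
    have "graph_path G (a @ [y])"
      using p(1) unfolding ab graph_path_def by (auto simp: successively_append_iff)
    moreover have "hd (a @ [y]) = u" using p(2) ab by (cases a) auto
    ultimately show ?thesis by force
  next
    case False
    have "graph_path G (p @ [y])"
      using p y False step.hyps unfolding graph_path_def by (auto simp: successively_append_iff)
    moreover have "hd (p @ [y]) = u" using p by (auto simp: graph_path_def)
    ultimately show ?thesis by force
  qed
qed

text \<open>Descending along ever smaller neighbours leads every vertex to 0.\<close>

lemma connected_graph_on:
  assumes sym: "\<And>x y. x < n \<Longrightarrow> y < n \<Longrightarrow> adj x y \<Longrightarrow> adj y x"
    and "0 < n"
    and down: "\<And>x. 0 < x \<Longrightarrow> x < n \<Longrightarrow> \<exists>y<x. adj x y"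
  shows "graph_connected (graph_on n adj)"
proof -
  let ?G = "graph_on n adj"
  note adj_iff = gadj_graph_on[of n adj, OF sym]
  have to0: "(gadj ?G)\<^sup>*\<^sup>* x 0" if "x < n" for x
    using that
  proof (induction x rule: less_induct)
    case (less x)
    show ?case
    proof (cases "x = 0")
      case False
      then obtain y where y: "y < x" "adj x y" using down less.prems by blast
      then have "gadj ?G x y" using less.prems adj_iff by auto
      moreover have "(gadj ?G)\<^sup>*\<^sup>* y 0" using less y by simp
      ultimately show ?thesis by (rule converse_rtranclp_into_rtranclp)
    qed simp
  qed
  have "symp (gadj ?G)" by (simp add: symp_def gadj_sym)
  then have from0: "(gadj ?G)\<^sup>*\<^sup>* 0 x" if "x < n" for x
    using to0[OF that] by (meson symp_rtranclp sympD)
  show ?thesis unfolding graph_connected_def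
  proof (intro conjI ballI)
    show "gverts ?G \<noteq> {}" using \<open>0 < n\<close> by auto
    fix u v assume "u \<in> gverts ?G" "v \<in> gverts ?G"
    then show "\<exists>p. graph_path ?G p \<and> hd p = u \<and> last p = v"
      using walk_imp_path[OF simple_graph_on] to0[of u] from0[of v] rtranclp_trans by fastforce
  qed
qed

lemma no_gallai_vertexI:
  assumes "\<And>p. graph_path G p \<Longrightarrow> length p \<le> k"
    and "\<And>v. v \<in> gverts G \<Longrightarrow> \<exists>p. graph_path G p \<and> length p = k \<and> v \<notin> set p"
  shows "\<not> (\<exists>v. gallai_vertex G v)"
  using assms unfolding gallai_vertex_def longest_path_def by metis

lemma fixer_embeds:
  assumes "fixer H" "simple_graph G" "graph_connected G" "\<not> (\<exists>v. gallai_vertex G v)"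
  obtains f :: "'a \<Rightarrow> nat" where "inj_on f (gverts H)" "f ` gverts H \<subseteq> gverts G"
    "\<And>u v. u \<in> gverts H \<Longrightarrow> v \<in> gverts H \<Longrightarrow> gadj H u v \<longleftrightarrow> gadj G (f u) (f v)"
proof -
  have "\<not> induced_free H G" using assms by (auto simp: fixer_def)
  then obtain S f where S: "S \<subseteq> gverts G" "bij_betw f (gverts H) S"
    and f: "\<And>u v. u \<in> gverts H \<Longrightarrow> v \<in> gverts H \<Longrightarrow> gadj H u v \<longleftrightarrow> gadj (induced_on G S) (f u) (f v)"
    by (auto simp: induced_free_def graph_isomorphic_def induced_on_def)
  have fS: "f u \<in> S" if "u \<in> gverts H" for u using S that by (auto simp: bij_betw_def)
  show thesis
  proof
    show "inj_on f (gverts H)" "f ` gverts H \<subseteq> gverts G" using S by (auto simp: bij_betw_def)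
    show "gadj H u v \<longleftrightarrow> gadj G (f u) (f v)" if "u \<in> gverts H" "v \<in> gverts H" for u v
      using f[OF that] fS[OF that(1)] fS[OF that(2)] by (auto simp: gadj_def induced_on_def)
  qed
qed

section \<open>Walther's graph and its truncation\<close>

text \<open>The vertices 0 to 5 form a hexagon, the hub \<open>6 + i\<close> is joined to the opposite hexagon vertices
  \<open>i\<close> and \<open>i + 3\<close>, and the leaf \<open>9 + i\<close> hangs on the hub \<open>6 + i\<close>. Identifying the three leaves yields
  the Petersen graph.\<close>

definition nbrs :: "nat \<Rightarrow> nat list" where
  "nbrs w = [[1,5,6], [0,2,7], [1,3,8], [2,4,6], [3,5,7], [0,4,8],
             [0,3,9], [1,4,10], [2,5,11], [6], [7], [8]] ! w"

definition walther :: "nat sgraph" where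
  "walther = graph_on 12 (\<lambda>u w. w \<in> set (nbrs u))"

text \<open>In the truncated graph the triangle of \<open>w\<close> consists of \<open>3 * w\<close>, \<open>3 * w + 1\<close> and \<open>3 * w + 2\<close>, and the
  corner \<open>3 * w + j\<close> receives the edge from \<open>w\<close> to its \<open>j\<close>-th neighbour. A leaf has just one
  neighbour, so two corners of its triangle receive no edge. The predicate \<open>joined\<close> is directed: it
  says that the corner \<open>x\<close> points to the triangle of \<open>y\<close>; an edge needs both directions.\<close>

definition joined :: "nat \<Rightarrow> nat \<Rightarrow> bool" where
  "joined x y \<longleftrightarrow> x mod 3 < length (nbrs (x div 3)) \<and> nbrs (x div 3) ! (x mod 3) = y div 3"

definition tadj :: "nat \<Rightarrow> nat \<Rightarrow> bool" where
  "tadj x y \<longleftrightarrow> x div 3 = y div 3 \<or> joined x y \<and> joined y x"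

definition truncated_walther :: "nat sgraph" where
  "truncated_walther = graph_on 36 tadj"

text \<open>Quantifiers over the elements of an explicit list evaluate much faster than bounded ones.\<close>

lemma all_lessI: "\<forall>x\<in>set [0..<n]. P x \<Longrightarrow> \<forall>x<n. P x"
  by simp

lemma nbrs_all: "\<forall>u<12. \<forall>w\<in>set (nbrs u). w < 12 \<and> w \<noteq> u \<and> u \<in> set (nbrs w)"
  by (rule all_lessI) code_simp

lemma nbrs_props:
  assumes "u < 12" "w \<in> set (nbrs u)"
  shows "w < 12" "w \<noteq> u" "u \<in> set (nbrs w)"
  using nbrs_all assms by blast+

lemma distinct_nbrs: "u < 12 \<Longrightarrow> distinct (nbrs u)"
proof -
  have "\<forall>u<12. distinct (nbrs u)" by (rule all_lessI) code_simp
  then show "u < 12 \<Longrightarrow> distinct (nbrs u)" by simp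
qed

lemma gverts_walther [simp]: "gverts walther = {..<12}"
  by (simp add: walther_def)

lemma gverts_truncated [simp]: "gverts truncated_walther = {..<36}"
  by (simp add: truncated_walther_def)

lemma gadj_walther: "gadj walther u w \<longleftrightarrow> u < 12 \<and> w \<in> set (nbrs u)"
proof -
  have "gadj walther u w \<longleftrightarrow> u < 12 \<and> w < 12 \<and> u \<noteq> w \<and> w \<in> set (nbrs u)"
    unfolding walther_def by (rule gadj_graph_on) (rule nbrs_props(3))
  then show ?thesis using nbrs_props(1,2) by blast
qed

lemma gadj_truncated:
  "gadj truncated_walther x y \<longleftrightarrow> x < 36 \<and> y < 36 \<and> x \<noteq> y \<and> tadj x y"
  unfolding truncated_walther_def by (subst gadj_graph_on) (auto simp: tadj_def)

lemma walther_triangle_free: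
  assumes "gadj walther u v" "gadj walther v w"
  shows "\<not> gadj walther u w"
proof -
  have "\<forall>u<12. \<forall>v\<in>set (nbrs u). \<forall>w\<in>set (nbrs v). w \<notin> set (nbrs u)"
    by (rule all_lessI) code_simp
  then show ?thesis using assms unfolding gadj_walther by blast
qed

lemma walther_square_free:
  assumes "gadj walther u v" "gadj walther v w" "gadj walther w x" "gadj walther x u"
  shows "u = w \<or> v = x"
proof -
  have "\<forall>u<12. \<forall>v\<in>set (nbrs u). \<forall>w\<in>set (nbrs v). \<forall>x\<in>set (nbrs w).
          u \<in> set (nbrs x) \<longrightarrow> u = w \<or> v = x"
    by (rule all_lessI) code_simp
  then show ?thesis using assms unfolding gadj_walther by blast
qed

lemma walther_connected: "graph_connected walther"
proof -
  have "\<forall>x<12. x = 0 \<or> (\<exists>y\<in>set [0..<x]. y \<in> set (nbrs x))" by (rule all_lessI) code_simp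
  then have down: "\<exists>y<x. y \<in> set (nbrs x)" if "0 < x" "x < 12" for x
    using that by fastforce
  show ?thesis unfolding walther_def
    by (rule connected_graph_on) (metis nbrs_props(3), simp, rule down)
qed

lemma truncated_connected: "graph_connected truncated_walther"
proof -
  have "\<forall>x<36. x = 0 \<or> (\<exists>y\<in>set [0..<x]. tadj x y)" by (rule all_lessI) code_simp
  then have down: "\<exists>y<x. tadj x y" if "0 < x" "x < 36" for x
    using that by fastforce
  show ?thesis unfolding truncated_walther_def
    by (rule connected_graph_on) (force simp: tadj_def, simp, rule down)
qed

lemma joined_unique:
  assumes "joined x y" "joined x' y'" "x div 3 = x' div 3" "y div 3 = y' div 3" "x < 36"
  shows "x = x'"
proof -
  have "distinct (nbrs (x div 3))" using assms(5) by (intro distinct_nbrs) simp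
  then have "x mod 3 = x' mod 3"
    using assms nth_eq_iff_index_eq unfolding joined_def by metis
  then show ?thesis using assms(3) by (metis div_mult_mod_eq)
qed

lemma truncated_cross_edge:
  assumes "gadj truncated_walther x y" "x div 3 \<noteq> y div 3"
  shows "joined x y" "gadj walther (x div 3) (y div 3)"
  using assms by (auto simp: gadj_truncated gadj_walther tadj_def joined_def dest!: nth_mem)

lemma truncated_cross_edge_unique:
  assumes "gadj truncated_walther x y" "gadj truncated_walther x' y'" "x div 3 \<noteq> y div 3"
    "x div 3 = x' div 3" "y div 3 = y' div 3"
  shows "x = x'"
proof (rule joined_unique)
  show "joined x y" "joined x' y'"
    using truncated_cross_edge(1)[OF assms(1)] truncated_cross_edge(1)[OF assms(2)] assms(3-5) by auto
  show "x < 36" using assms(1) by (simp add: gadj_truncated)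
qed (fact assms)+

lemma truncated_cross_nbr_unique:
  assumes "gadj truncated_walther x y" "gadj truncated_walther x y'"
    "x div 3 \<noteq> y div 3" "x div 3 \<noteq> y' div 3"
  shows "y = y'"
proof -
  have "y div 3 = y' div 3"
    using assms truncated_cross_edge(1) unfolding joined_def by metis
  then show ?thesis
    using assms truncated_cross_edge_unique[of y x y' x] gadj_sym by metis
qed

text \<open>Of three neighbours of a vertex, only one can lie outside its triangle, and the other two are the
  remaining corners of that triangle.\<close>

lemma truncated_claw_free:
  assumes "gadj truncated_walther x a" "gadj truncated_walther x b" "gadj truncated_walther x c"
    "a \<noteq> b" "a \<noteq> c" "b \<noteq> c"
  shows "gadj truncated_walther a b \<or> gadj truncated_walther a c \<or> gadj truncated_walther b c"
proof -
  have same: "gadj truncated_walther y z"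
    if "gadj truncated_walther x y" "gadj truncated_walther x z" "x div 3 = y div 3" "x div 3 = z div 3" "y \<noteq> z"
    for y z using that by (auto simp: gadj_truncated tadj_def)
  have other: "y = z"
    if "gadj truncated_walther x y" "gadj truncated_walther x z" "x div 3 \<noteq> y div 3" "x div 3 \<noteq> z div 3"
    for y z using truncated_cross_nbr_unique[OF that] .
  show ?thesis
    using same[OF assms(1,2)] same[OF assms(1,3)] same[OF assms(2,3)] other[OF assms(1,2)]
      other[OF assms(1,3)] other[OF assms(2,3)] assms(4-6) by blast
qed

section \<open>Trails in Walther's graph\<close>

text \<open>Projecting a path of the truncated graph to Walther's graph gives a walk that pauses while the path
  stays inside a triangle. Pauses are therefore allowed in the notion of trail, and only the genuine
  moves count as traversed edges.\<close>

definition moves :: "'b list \<Rightarrow> ('b \<times> 'b) list" where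
  "moves q = filter (\<lambda>(x, y). x \<noteq> y) (zip q (tl q))"

definition move_edges :: "'b list \<Rightarrow> 'b set list" where
  "move_edges q = map (\<lambda>(x, y). {x, y}) (moves q)"

definition lazy_trail :: "nat list \<Rightarrow> bool" where
  "lazy_trail q \<longleftrightarrow> q \<noteq> [] \<and> set q \<subseteq> {..<12} \<and>
     successively (\<lambda>x y. x = y \<or> y \<in> set (nbrs x)) q \<and> distinct (move_edges q)"

lemma moves_Cons2: "moves (x # y # q) = (if x = y then [] else [(x, y)]) @ moves (y # q)"
  by (simp add: moves_def)

text \<open>Each crossing toggles membership in \<open>S\<close>.\<close>

lemma even_crossings:
  "q \<noteq> [] \<Longrightarrow> even (length (filter (\<lambda>(x, y). (x \<in> S) \<noteq> (y \<in> S)) (moves q)))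
     \<longleftrightarrow> (hd q \<in> S \<longleftrightarrow> last q \<in> S)"
proof (induction q rule: induct_list012)
  case (2 x)
  show ?case by (simp add: moves_def)
next
  case (3 x y zs)
  then show ?case by (auto simp: moves_Cons2)
qed simp

lemma crossing_move:
  assumes "z \<in> set q" "z \<in> S" "hd q \<notin> S"
  obtains x y where "(x, y) \<in> set (moves q)" "x \<notin> S" "y \<in> S"
proof -
  have "\<exists>(x, y) \<in> set (moves q). x \<notin> S \<and> y \<in> S"
    using assms
  proof (induction q rule: induct_list012)
    case (3 x y zs)
    then show ?case by (cases "y \<in> S") (auto simp: moves_Cons2)
  qed auto
  then show thesis using that by blast
qed

lemma moves_successively:
  assumes "successively R q" "(x, y) \<in> set (moves q)"
  shows "R x y" "x \<noteq> y" "x \<in> set q" "y \<in> set q"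
proof -
  have z: "(x, y) \<in> set (zip q (tl q))" and "x \<noteq> y" using assms(2) by (auto simp: moves_def)
  show "x \<noteq> y" by fact
  show "x \<in> set q" using z by (rule set_zip_leftD)
  show "y \<in> set q" using set_zip_rightD[OF z] by (cases q) auto
  show "R x y" using assms(1) z by (auto simp: successively_conv_nth set_zip nth_tl)
qed

lemma lazy_trail_move:
  assumes "lazy_trail q" "(x, y) \<in> set (moves q)"
  shows "y \<in> set (nbrs x)" "x \<in> set (nbrs y)" "{x, y} \<in> set (move_edges q)" "x < 12" "y < 12"
proof -
  show x: "x < 12" and "y < 12"
    using assms moves_successively[of _ q x y] unfolding lazy_trail_def by blast+
  show n: "y \<in> set (nbrs x)"
    using assms moves_successively[of "\<lambda>x y. x = y \<or> y \<in> set (nbrs x)" q x y]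
    by (auto simp: lazy_trail_def)
  show "x \<in> set (nbrs y)" using nbrs_props(3)[OF x n] .
  show "{x, y} \<in> set (move_edges q)" using assms(2) by (force simp: move_edges_def)
qed

lemma lazy_trail_edge:
  assumes "lazy_trail q" "{w, v} \<in> set (move_edges q)"
  shows "v \<in> set (nbrs w)" "v \<in> set q"
proof -
  obtain x y where xy: "(x, y) \<in> set (moves q)" "{w, v} = {x, y}"
    using assms(2) by (auto simp: move_edges_def)
  show "v \<in> set (nbrs w)" "v \<in> set q"
    using xy lazy_trail_move[OF assms(1) xy(1)] assms(1)
      moves_successively[OF _ xy(1)] unfolding lazy_trail_def doubleton_eq_iff by blast+
qed

text \<open>The crossings of \<open>{w}\<close> are the traversed edges at \<open>w\<close>. No edge is traversed twice, so they can be
  counted through the neighbours of \<open>w\<close>, and their parity is that of \<open>even_crossings\<close>.\<close>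

lemma lazy_trail_degree:
  assumes "lazy_trail q" "w < 12"
  shows "even (length (filter (\<lambda>v. {w, v} \<in> set (move_edges q)) (nbrs w)))
           \<longleftrightarrow> (hd q = w \<longleftrightarrow> last q = w)"
proof -
  let ?E = "move_edges q"
  have "filter (\<lambda>e. w \<in> e) ?E
      = map (\<lambda>(x, y). {x, y}) (filter (\<lambda>(x, y). (x \<in> {w}) \<noteq> (y \<in> {w})) (moves q))"
    unfolding move_edges_def filter_map
    by (intro arg_cong[where f = "map _"] filter_cong) (auto simp: moves_def)
  then have "length (filter (\<lambda>(x, y). (x \<in> {w}) \<noteq> (y \<in> {w})) (moves q))
      = length (filter (\<lambda>e. w \<in> e) ?E)" by simp
  also have "\<dots> = card {e \<in> set ?E. w \<in> e}"
    using assms(1) by (simp add: lazy_trail_def distinct_length_filter Int_def conj_commute)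
  also have "{e \<in> set ?E. w \<in> e} = (\<lambda>v. {w, v}) ` {v \<in> set (nbrs w). {w, v} \<in> set ?E}"
  proof (intro equalityI subsetI)
    fix e assume e: "e \<in> {e \<in> set ?E. w \<in> e}"
    then obtain x y where "e = {x, y}" "w \<in> {x, y}" by (auto simp: move_edges_def)
    then obtain v where "e = {w, v}" by (metis insert_commute insertE singletonD)
    then show "e \<in> (\<lambda>v. {w, v}) ` {v \<in> set (nbrs w). {w, v} \<in> set ?E}"
      using e lazy_trail_edge(1)[OF assms(1), of w v] by auto
  qed auto
  also have "card \<dots> = card {v \<in> set (nbrs w). {w, v} \<in> set ?E}"
    by (intro card_image inj_onI) (auto simp: doubleton_eq_iff)
  also have "\<dots> = length (filter (\<lambda>v. {w, v} \<in> set ?E) (nbrs w))"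
    using distinct_nbrs[OF assms(2)] by (simp add: distinct_length_filter Int_def conj_commute)
  finally show ?thesis
    using even_crossings[of q "{w}"] assms(1) by (auto simp: lazy_trail_def)
qed

text \<open>To visit \<open>S\<close> from outside, a trail has to enter it. Applied to a single vertex, this says that a
  visited vertex has a traversed edge; applied to a 5-cycle, it prevents the traversed edges from
  closing up around that cycle.\<close>

lemma lazy_trail_cut:
  assumes "lazy_trail q" "z \<in> set q" "z \<in> S" "hd q \<notin> S"
  shows "\<exists>w\<in>S. \<exists>v\<in>set (nbrs w). v \<notin> S \<and> {w, v} \<in> set (move_edges q)"
proof -
  obtain x y where xy: "(x, y) \<in> set (moves q)" "x \<notin> S" "y \<in> S"
    using crossing_move[OF assms(2-4)] .
  then show ?thesis using lazy_trail_move[OF assms(1) xy(1)] by (metis insert_commute)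
qed

text \<open>Passing through a vertex takes two edges, and a leaf has only one.\<close>

lemma lazy_trail_leaf_end:
  assumes "lazy_trail q" "w \<in> set q" "w < 12" "length (nbrs w) = 1"
  shows "hd q = w \<or> last q = w"
proof (rule ccontr)
  assume no: "\<not> ?thesis"
  then have "even (length (filter (\<lambda>v. {w, v} \<in> set (move_edges q)) (nbrs w)))"
    using lazy_trail_degree[OF assms(1,3)] by blast
  moreover have "\<exists>v\<in>set (nbrs w). {w, v} \<in> set (move_edges q)"
    using lazy_trail_cut[OF assms(1,2), of "{w}"] no by blast
  moreover obtain v where "nbrs w = [v]" using assms(4) by (auto simp: length_Suc_conv)
  ultimately show False by simp
qed

lemma nbrs_simps:
  "nbrs 0 = [1,5,6]" "nbrs 1 = [0,2,7]" "nbrs 2 = [1,3,8]" "nbrs 3 = [2,4,6]"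
  "nbrs 4 = [3,5,7]" "nbrs 5 = [0,4,8]" "nbrs 6 = [0,3,9]" "nbrs 7 = [1,4,10]"
  "nbrs 8 = [2,5,11]" "nbrs 9 = [6]" "nbrs 10 = [7]" "nbrs 11 = [8]"
  by (simp_all add: nbrs_def)

lemma even_filter3: "even (length (filter P [a, b, c])) \<longleftrightarrow> (P a \<noteq> P b) = P c"
  by simp

text \<open>Suppose that eleven vertices are visited. Visited leaves are ends of the trail, so exactly one leaf
  \<open>c\<close> is missed, the other two are the ends, and every cubic vertex is visited. By parity exactly two
  edges are traversed at each cubic vertex. In the Petersen graph, where the leaves are identified,
  the traversed edges thus form a 2-factor, and every 2-factor of the Petersen graph consists of two
  disjoint 5-cycles. One of these avoids the identified leaves and is the hub next to \<open>c\<close> together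
  with four consecutive hexagon vertices. The trail would have to enter that pentagon from outside,
  but none of the edges leaving it is traversed.\<close>

lemma lazy_trail_visits_le_10:
  assumes t: "lazy_trail q"
  shows "card (set q) \<le> 10"
proof (rule ccontr)
  assume "\<not> ?thesis"
  moreover have sub: "set q \<subseteq> {..<12}" using t by (simp add: lazy_trail_def)
  ultimately have "card ({..<12} - set q) \<le> 1"
    by (subst card_Diff_subset) auto
  then have miss: "a = b" if "a < 12" "b < 12" "a \<notin> set q" "b \<notin> set q" for a b
    using that by (auto simp: card_le_Suc0_iff_eq)
  \<comment> \<open>From here on the trail matters only through the Boolean \<open>x u w\<close>: the edge \<open>uw\<close> is traversed.\<close>
  define x where "x = (\<lambda>u w. {u, w} \<in> set (move_edges q))"
  have x_sym: "x u w = x w u" for u w by (simp add: x_def insert_commute)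
  have deg: "even (length (filter (x w) (nbrs w))) \<longleftrightarrow> (hd q = w \<longleftrightarrow> last q = w)" if "w < 12" for w
    using lazy_trail_degree[OF t that] by (simp add: x_def)
  have cut: "\<exists>w\<in>S. \<exists>v\<in>set (nbrs w). v \<notin> S \<and> x w v" if "z \<in> set q" "z \<in> S" "hd q \<notin> S" for z S
    using lazy_trail_cut[OF t that] by (simp add: x_def)
  have leaf: "hd q = w \<or> last q = w" if "w \<in> {9, 10, 11}" "w \<in> set q" for w
    using lazy_trail_leaf_end[OF t that(2)] that(1) by (auto simp: nbrs_simps)
  have unused: "\<not> x u w" if "w \<notin> set q" for u w
    using that lazy_trail_edge(2)[OF t, of u w] by (auto simp: x_def)
  have "\<exists>c\<in>{9, 10, 11}. c \<notin> set q"
    using leaf[of 9] leaf[of 10] leaf[of 11] by auto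
  then obtain c where c: "c \<in> {9, 10, 11}" "c \<notin> set q" by blast
  have seen: "w \<in> set q" if "w < 12" "w \<noteq> c" for w
  proof -
    have "c < 12" using c(1) by auto
    then show ?thesis using miss[of w c] that c(2) by blast
  qed
  have ends: "{hd q, last q} = {9, 10, 11} - {c}"
    using c(1) leaf[of 9] leaf[of 10] leaf[of 11] seen[of 9] seen[of 10] seen[of 11] by auto
  then have "hd q \<in> {9, 10, 11}" "last q \<in> {9, 10, 11}" by blast+
  then have core: "hd q \<noteq> w" "last q \<noteq> w" if "w < 9" for w
    using that by auto
  have even_core: "even (length (filter (x w) (nbrs w)))" if "w < 9" for w
    using deg[of w] core[OF that] that by simp
  have cycle_cut: "\<exists>w\<in>S. \<exists>v\<in>set (nbrs w). v \<notin> S \<and> x w v" if "z \<in> S" "S \<subseteq> {..<9}" for z S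
  proof (rule cut)
    have "z < 9" using that by auto
    moreover have "z \<noteq> c" using \<open>z < 9\<close> c(1) by auto
    ultimately show "z \<in> set q" by (intro seen) simp_all
    show "hd q \<notin> S" using core(1) that(2) by blast
  qed (fact that(1))
  have swap:
    "x 1 0 = x 0 1" "x 5 0 = x 0 5" "x 6 0 = x 0 6" "x 2 1 = x 1 2" "x 7 1 = x 1 7"
    "x 3 2 = x 2 3" "x 8 2 = x 2 8" "x 4 3 = x 3 4" "x 6 3 = x 3 6" "x 5 4 = x 4 5"
    "x 7 4 = x 4 7" "x 8 5 = x 5 8" "x 9 6 = x 6 9" "x 10 7 = x 7 10" "x 11 8 = x 8 11"
    by (rule x_sym)+
  have parity:
    "(x 0 1 \<noteq> x 0 5) = x 0 6" "(x 0 1 \<noteq> x 1 2) = x 1 7"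
    "(x 1 2 \<noteq> x 2 3) = x 2 8" "(x 2 3 \<noteq> x 3 4) = x 3 6"
    "(x 3 4 \<noteq> x 4 5) = x 4 7" "(x 0 5 \<noteq> x 4 5) = x 5 8"
    "(x 0 6 \<noteq> x 3 6) = x 6 9" "(x 1 7 \<noteq> x 4 7) = x 7 10"
    "(x 2 8 \<noteq> x 5 8) = x 8 11"
    using even_core[of 0] even_core[of 1] even_core[of 2] even_core[of 3] even_core[of 4]
      even_core[of 5] even_core[of 6] even_core[of 7] even_core[of 8]
    by (simp_all only: nbrs_simps swap even_filter3)
  have visited:
    "x 0 1 \<or> x 0 5 \<or> x 0 6" "x 0 1 \<or> x 1 2 \<or> x 1 7"
    "x 1 2 \<or> x 2 3 \<or> x 2 8" "x 2 3 \<or> x 3 4 \<or> x 3 6"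
    "x 3 4 \<or> x 4 5 \<or> x 4 7" "x 0 5 \<or> x 4 5 \<or> x 5 8"
    "x 0 6 \<or> x 3 6 \<or> x 6 9" "x 1 7 \<or> x 4 7 \<or> x 7 10"
    "x 2 8 \<or> x 5 8 \<or> x 8 11"
    using cycle_cut[of 0 "{0}"] cycle_cut[of 1 "{1}"] cycle_cut[of 2 "{2}"] cycle_cut[of 3 "{3}"]
      cycle_cut[of 4 "{4}"] cycle_cut[of 5 "{5}"] cycle_cut[of 6 "{6}"] cycle_cut[of 7 "{7}"]
      cycle_cut[of 8 "{8}"]
    by (simp_all add: nbrs_simps swap del: One_nat_def)
  have pentagons:
    "x 6 9 \<or> x 0 5 \<or> x 1 7 \<or> x 2 8 \<or> x 3 4"
    "x 6 9 \<or> x 2 3 \<or> x 4 7 \<or> x 5 8 \<or> x 0 1"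
    "x 7 10 \<or> x 0 1 \<or> x 2 8 \<or> x 3 6 \<or> x 4 5"
    "x 7 10 \<or> x 3 4 \<or> x 5 8 \<or> x 0 6 \<or> x 1 2"
    "x 8 11 \<or> x 1 2 \<or> x 3 6 \<or> x 4 7 \<or> x 0 5"
    "x 8 11 \<or> x 4 5 \<or> x 0 6 \<or> x 1 7 \<or> x 2 3"
    using cycle_cut[of 6 "{6, 0, 1, 2, 3}"] cycle_cut[of 6 "{6, 3, 4, 5, 0}"]
      cycle_cut[of 7 "{7, 1, 2, 3, 4}"] cycle_cut[of 7 "{7, 4, 5, 0, 1}"]
      cycle_cut[of 8 "{8, 2, 3, 4, 5}"] cycle_cut[of 8 "{8, 5, 0, 1, 2}"]
    by (simp_all add: nbrs_simps swap del: One_nat_def)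
  \<comment> \<open>With the edge at \<open>c\<close> unused, parity leaves two 2-factors, and each of them violates one pentagon.\<close>
  consider "c = 9" | "c = 10" | "c = 11" using c by auto
  then show False
  proof cases
    case 1
    have "{hd q, last q} = {10, 11}" unfolding ends 1 by auto
    then have "hd q = 10 \<and> last q = 11 \<or> hd q = 11 \<and> last q = 10"
      unfolding doubleton_eq_iff .
    then have "\<not> x 6 9" "x 7 10" "x 8 11"
      using unused[of 9] 1 c(2) deg[of 10] deg[of 11] by (auto simp: nbrs_simps swap split: if_splits)
    then show False using parity visited pentagons by sat
  next
    case 2
    have "{hd q, last q} = {9, 11}" unfolding ends 2 by auto
    then have "hd q = 9 \<and> last q = 11 \<or> hd q = 11 \<and> last q = 9"
      unfolding doubleton_eq_iff .
    then have "x 6 9" "\<not> x 7 10" "x 8 11"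
      using unused[of 10] 2 c(2) deg[of 9] deg[of 11] by (auto simp: nbrs_simps swap split: if_splits)
    then show False using parity visited pentagons by sat
  next
    case 3
    have "{hd q, last q} = {9, 10}" unfolding ends 3 by auto
    then have "hd q = 9 \<and> last q = 10 \<or> hd q = 10 \<and> last q = 9"
      unfolding doubleton_eq_iff .
    then have "x 6 9" "x 7 10" "\<not> x 8 11"
      using unused[of 11] 3 c(2) deg[of 9] deg[of 10] by (auto simp: nbrs_simps swap split: if_splits)
    then show False using parity visited pentagons by sat
  qed
qed

section \<open>Longest paths\<close>

text \<open>The map \<open>f\<close> projects \<open>G\<close> to Walther's graph so that over each edge there is at most one edge of \<open>G\<close>.
  Then a path, which uses no edge twice, projects to a trail. That trail visits at most ten vertices,
  over each of which the path has at most \<open>m\<close> vertices. The identity with \<open>m = 1\<close> handles Walther's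
  graph itself, and division by 3 with \<open>m = 3\<close> its truncation.\<close>

lemma path_length_le:
  assumes path: "graph_path G p" and "finite (gverts G)"
    and fibre: "\<And>w. w < 12 \<Longrightarrow> card {x \<in> gverts G. f x = w} \<le> m"
    and range: "\<And>x. x \<in> gverts G \<Longrightarrow> f x < 12"
    and adj: "\<And>x y. gadj G x y \<Longrightarrow> f x = f y \<or> f y \<in> set (nbrs (f x))"
    and unique: "\<And>x y x' y'. gadj G x y \<Longrightarrow> gadj G x' y' \<Longrightarrow> f x \<noteq> f y \<Longrightarrow>
                   f x = f x' \<Longrightarrow> f y = f y' \<Longrightarrow> x = x'"
  shows "length p \<le> 10 * m"
proof -
  have p: "p \<noteq> []" "set p \<subseteq> gverts G" "distinct p" "successively (gadj G) p"
    using path by (auto simp: graph_path_def)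
  let ?steps = "filter (\<lambda>(x, y). f x \<noteq> f y) (zip p (tl p))"
  have moves: "moves (map f p) = map (\<lambda>(x, y). (f x, f y)) ?steps"
    by (simp add: moves_def map_tl[symmetric] zip_map_map filter_map o_def case_prod_unfold)
  have step: "gadj G x y \<and> f x \<noteq> f y" if "(x, y) \<in> set ?steps" for x y
    using that p(4) by (auto simp: successively_conv_nth set_zip nth_tl)
  have index: "\<exists>i. Suc i < length p \<and> p ! i = x \<and> p ! Suc i = y"
    if "(x, y) \<in> set (zip p (tl p))" for x y
    using that by (auto simp: set_zip nth_tl less_diff_conv)
  \<comment> \<open>Over one edge the path could only move to and fro on the same edge of \<open>G\<close>, repeating a vertex.\<close>
  have no_return: "(y, x) \<notin> set (zip p (tl p))" if xy: "(x, y) \<in> set (zip p (tl p))" for x y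
  proof
    assume "(y, x) \<in> set (zip p (tl p))"
    then obtain i j where "Suc i < length p" "Suc j < length p"
      "p ! i = x" "p ! Suc i = y" "p ! j = y" "p ! Suc j = x"
      using index xy by metis
    then have "Suc i = j" "Suc j = i" using p(3) by (metis Suc_lessD nth_eq_iff_index_eq)+
    then show False by simp
  qed
  have inj: "inj_on (\<lambda>(x, y). {f x, f y}) (set ?steps)"
  proof (rule inj_onI, clarify)
    fix x y x' y'
    assume a: "(x, y) \<in> set ?steps" "(x', y') \<in> set ?steps" "{f x, f y} = {f x', f y'}"
    have g: "gadj G x y" "gadj G y x" "gadj G x' y'" "gadj G y' x'" "f x \<noteq> f y"
      using step[OF a(1)] step[OF a(2)] gadj_sym[of G] by blast+
    have "x = y' \<and> y = x'" if "f x = f y'" "f y = f x'"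
      using unique[OF g(1,4,5)] unique[OF g(2,3)] g(5) that by metis
    moreover have "(x, y) \<in> set (zip p (tl p))" "(x', y') \<in> set (zip p (tl p))"
      using a(1,2) by simp_all
    ultimately have "\<not> (f x = f y' \<and> f y = f x')" using no_return by blast
    then have "f x = f x'" "f y = f y'" using a(3) unfolding doubleton_eq_iff by blast+
    then show "x = x' \<and> y = y'"
      using unique[OF g(1,3,5)] unique[OF g(2,4)] g(5) by metis
  qed
  have edges: "move_edges (map f p) = map (\<lambda>(x, y). {f x, f y}) ?steps"
    by (simp add: move_edges_def moves o_def case_prod_unfold)
  have "distinct ?steps" using p(3) by (intro distinct_filter distinct_zipI1)
  then have "distinct (move_edges (map f p))"
    unfolding edges distinct_map using inj by (rule conjI)
  moreover have "successively (\<lambda>x y. x = y \<or> y \<in> set (nbrs x)) (map f p)"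
    using p(4) adj by (auto simp: successively_map intro: successively_mono)
  ultimately have "lazy_trail (map f p)"
    using p range by (auto simp: lazy_trail_def)
  then have ten: "card (f ` set p) \<le> 10" using lazy_trail_visits_le_10 by fastforce
  have "set p = (\<Union>w\<in>f ` set p. {x \<in> set p. f x = w})" by auto
  then have "length p \<le> (\<Sum>w\<in>f ` set p. card {x \<in> set p. f x = w})"
    using p(3) card_UN_le[of "f ` set p" "\<lambda>w. {x \<in> set p. f x = w}"] by (simp add: distinct_card)
  also have "\<dots> \<le> (\<Sum>w\<in>f ` set p. m)"
  proof (rule sum_mono)
    fix w assume "w \<in> f ` set p"
    then have "card {x \<in> gverts G. f x = w} \<le> m" using p(2) range by (intro fibre) auto
    moreover have "card {x \<in> set p. f x = w} \<le> card {x \<in> gverts G. f x = w}"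
      using p(2) assms(2) by (intro card_mono) auto
    ultimately show "card {x \<in> set p. f x = w} \<le> m" by simp
  qed
  also have "\<dots> = card (f ` set p) * m" by simp
  also have "\<dots> \<le> 10 * m" using ten by simp
  finally show ?thesis .
qed

text \<open>Together with the split vertex, each of these leaf-to-leaf paths is a 9-cycle of the Petersen graph.
  The one missing the hexagon vertex 0 is listed first and the one missing the hub 6 is listed seventh;
  the others are, up to reversal, their images under rotations of the hexagon.\<close>

definition detours :: "nat list list" where
  "detours =
    [[9,6,3,2,1,7,4,5,8,11], [10,7,4,3,2,8,5,0,6,9], [11,8,5,4,3,6,0,1,7,10],
     [9,6,0,5,4,7,1,2,8,11], [10,7,1,0,5,8,2,3,6,9], [11,8,2,1,0,6,3,4,7,10],
     [10,7,1,0,5,4,3,2,8,11], [9,6,0,5,4,3,2,1,7,10], [9,6,0,1,2,3,4,5,8,11]]"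

text \<open>A path \<open>q\<close> from leaf to leaf lifts to the truncated graph by walking through all three corners of
  every triangle on the way. In the triangle of \<open>w\<close>, between \<open>u\<close> and \<open>v\<close>, the corners facing \<open>u\<close> and
  \<open>v\<close> come first and last; the one in between is found from the sum \<open>9 * w + 3\<close> of the three. A leaf
  has its only edge at corner 0, so the lift starts and ends at corner 2.\<close>

definition port :: "nat \<Rightarrow> nat \<Rightarrow> nat" where
  "port w u = 3 * w + length (takeWhile (\<lambda>v. v \<noteq> u) (nbrs w))"

fun inner_thread :: "nat list \<Rightarrow> nat list" where
  "inner_thread (u # w # v # ws) =
     [port w u, 9 * w + 3 - port w u - port w v, port w v] @ inner_thread (w # v # ws)"
| "inner_thread _ = []"

definition thread :: "nat list \<Rightarrow> nat list" where
  "thread q = [3 * hd q + 2, 3 * hd q + 1, 3 * hd q] @ inner_thread q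
                @ [3 * last q, 3 * last q + 1, 3 * last q + 2]"

lemma walther_no_gallai_vertex: "\<not> (\<exists>v. gallai_vertex walther v)"
proof (rule no_gallai_vertexI[where k = 10])
  show "length p \<le> 10" if "graph_path walther p" for p
  proof -
    have "card {x \<in> gverts walther. x = w} \<le> 1" for w
      using card_mono[of "{w}" "{x \<in> gverts walther. x = w}"] by auto
    then show ?thesis
      using path_length_le[of walther p "\<lambda>x. x" 1] that by (auto simp: gadj_walther)
  qed
  have paths: "\<forall>q\<in>set detours. length q = 10 \<and> distinct q
      \<and> successively (\<lambda>x y. y \<in> set (nbrs x)) q \<and> list_all (\<lambda>x. x < 12) q"
    by code_simp
  have "graph_path walther q" if "q \<in> set detours" for q
  proof -
    have "set q \<subseteq> {..<12}" using paths that by (auto simp: list_all_iff)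
    moreover have "successively (gadj walther) q"
      by (rule successively_mono[of "\<lambda>x y. y \<in> set (nbrs x)"])
         (use paths that calculation in \<open>auto simp: gadj_walther\<close>)
    ultimately show ?thesis using paths that by (force simp: graph_path_def)
  qed
  moreover have "\<forall>w<12. \<exists>q\<in>set detours. w \<notin> set q"
    by (rule all_lessI) code_simp
  ultimately show "\<exists>p. graph_path walther p \<and> length p = 10 \<and> v \<notin> set p"
    if "v \<in> gverts walther" for v
    using that paths by (metis atLeastLessThan_iff gverts_walther lessThan_iff set_upt zero_le)
qed

lemma truncated_no_gallai_vertex: "\<not> (\<exists>v. gallai_vertex truncated_walther v)"
proof (rule no_gallai_vertexI[where k = 30])
  show "length p \<le> 30" if p: "graph_path truncated_walther p" for p
  proof -
    have "card {x \<in> gverts truncated_walther. x div 3 = w} \<le> 3" for w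
    proof -
      have "{x \<in> gverts truncated_walther. x div 3 = w} \<subseteq> {3 * w..<3 * w + 3}" by auto
      from card_mono[OF _ this] show ?thesis by simp
    qed
    moreover have "x div 3 = y div 3 \<or> y div 3 \<in> set (nbrs (x div 3))"
      if "gadj truncated_walther x y" for x y
      using truncated_cross_edge(2)[OF that] by (auto simp: gadj_walther)
    ultimately have "length p \<le> 10 * 3"
      by (intro path_length_le[OF p, where f = "\<lambda>x. x div 3"])
         (use truncated_cross_edge_unique in auto)
    then show ?thesis by simp
  qed
  have paths: "\<forall>q\<in>set detours. length (thread q) = 30 \<and> distinct (thread q)
      \<and> successively tadj (thread q) \<and> list_all (\<lambda>x. x < 36) (thread q)"
    by code_simp
  have "graph_path truncated_walther (thread q)" if "q \<in> set detours" for q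
  proof -
    have s: "set (thread q) \<subseteq> {..<36}" using paths that by (auto simp: list_all_iff)
    have "successively (gadj truncated_walther) (thread q)"
      using paths that s unfolding successively_conv_nth
      by (auto simp: gadj_truncated nth_eq_iff_index_eq list_all_length)
    then show ?thesis using s paths that by (force simp: graph_path_def)
  qed
  moreover have "\<forall>x<36. \<exists>q\<in>set detours. x \<notin> set (thread q)"
    by (rule all_lessI) code_simp
  ultimately show "\<exists>p. graph_path truncated_walther p \<and> length p = 30 \<and> v \<notin> set p"
    if "v \<in> gverts truncated_walther" for v
    using that paths by (metis atLeastLessThan_iff gverts_truncated lessThan_iff set_upt zero_le)
qed

section \<open>Common induced subgraphs of the two graphs\<close>

text \<open>Take a longest path inside the component. An inner vertex already has both of its neighbours on the
  path, and an end vertex has no neighbour off it by maximality, so the path exhausts the component.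
  A chord would close a cycle.\<close>

lemma component_path:
  assumes H: "simple_graph H" "forest H" and C: "graph_component H C"
    and deg: "\<And>x a b c. gadj H x a \<Longrightarrow> gadj H x b \<Longrightarrow> gadj H x c \<Longrightarrow> a = b \<or> a = c \<or> b = c"
  shows "\<exists>n\<ge>1. graph_isomorphic (path_graph n) (induced_on H C)"
proof -
  let ?I = "induced_on H C"
  have CH: "C \<subseteq> gverts H" and conn: "graph_connected ?I" using C by (auto simp: graph_component_def)
  have vI: "gverts ?I = C" by (simp add: induced_on_def)
  have aI: "gadj ?I x y \<longleftrightarrow> gadj H x y \<and> x \<in> C \<and> y \<in> C" for x y
    by (auto simp: induced_on_def gadj_def)
  have fin: "finite C" using CH H(1) finite_subset by (auto simp: simple_graph_def)
  obtain v where v: "v \<in> C" using conn vI by (auto simp: graph_connected_def)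
  have "length q < Suc (card C)" if "graph_path ?I q" for q
    using that fin vI by (metis card_mono distinct_card graph_path_def le_imp_less_Suc)
  moreover have "graph_path ?I [v]" using v vI by (simp add: graph_path_def)
  ultimately obtain p where p: "graph_path ?I p"
    and max: "\<And>q. graph_path ?I q \<Longrightarrow> length q \<le> length p"
    using ex_has_greatest_nat[of "graph_path ?I" "[v]" length "Suc (card C)"] by blast
  have p': "p \<noteq> []" "set p \<subseteq> C" "distinct p" "successively (gadj ?I) p"
    using p vI by (auto simp: graph_path_def)
  have step: "gadj H (p ! i) (p ! Suc i)" if "Suc i < length p" for i
    using p'(4) that aI by (auto simp: successively_conv_nth)
  have closed: "y \<in> set p" if x: "x \<in> set p" and xy: "gadj ?I x y" for x y
  proof (rule ccontr)
    assume y: "y \<notin> set p"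
    obtain i where i: "i < length p" "p ! i = x" using x by (auto simp: in_set_conv_nth)
    have yC: "y \<in> C" using xy aI by blast
    have "i \<noteq> 0"
    proof
      assume "i = 0"
      then have "graph_path ?I (y # p)"
        using p' y yC xy i vI gadj_sym[of ?I x y]
        by (cases p) (auto simp: graph_path_def)
      then show False using max by fastforce
    qed
    moreover have "Suc i \<noteq> length p"
    proof
      assume "Suc i = length p"
      then have "last p = x" using i p'(1) by (metis diff_Suc_1 last_conv_nth)
      then have "graph_path ?I (p @ [y])"
        using p' y yC xy vI by (auto simp: graph_path_def successively_append_iff)
      then show False using max by fastforce
    qed
    ultimately obtain k where k: "i = Suc k" "Suc i < length p" using i(1) by (cases i) auto
    have "gadj H x (p ! k)" "gadj H x (p ! Suc i)" "gadj H x y"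
      using step[of k] step[of i] k i xy aI gadj_sym by (metis Suc_lessD)+
    then have "p ! k = p ! Suc i \<or> p ! k = y \<or> p ! Suc i = y" using deg by blast
    moreover have "p ! k \<noteq> p ! Suc i" using k p'(3) by (simp add: nth_eq_iff_index_eq)
    moreover have "p ! k \<in> set p" "p ! Suc i \<in> set p" using k by simp_all
    ultimately show False using y by blast
  qed
  have "set p = C"
  proof (rule antisym[OF p'(2)], rule subsetI)
    fix z assume "z \<in> C"
    then obtain r where r: "graph_path ?I r" "hd r = hd p" "last r = z"
      using conn p'(1,2) vI unfolding graph_connected_def by (metis hd_in_set subsetD)
    have "set r \<subseteq> set p" if "r \<noteq> []" "successively (gadj ?I) r" "hd r \<in> set p" for r
      using that
    proof (induction r rule: induct_list012)
      case (3 x y zs)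
      then show ?case using closed[of x y] by auto
    qed auto
    then show "z \<in> set p" using r p'(1) by (metis graph_path_def hd_in_set last_in_set subsetD)
  qed
  have chordless: "j \<le> Suc i" if "i < j" "j < length p" "gadj H (p ! i) (p ! j)" for i j
  proof (rule ccontr)
    assume far: "\<not> j \<le> Suc i"
    let ?c = "take (Suc j - i) (drop i p)"
    have len: "length ?c = Suc j - i" using that by simp
    have nth: "?c ! k = p ! (i + k)" if "k < Suc j - i" for k using that \<open>j < length p\<close> by simp
    have "set ?c \<subseteq> gverts H" using p'(2) CH by (meson dual_order.trans set_drop_subset set_take_subset)
    moreover have "successively (gadj H) ?c"
      using step that unfolding successively_conv_nth len by (auto simp: nth)
    ultimately have "graph_path H ?c"
      using p'(3) that by (auto simp: graph_path_def)
    moreover have "hd ?c = p ! i" "last ?c = p ! j"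
      using that nth[of 0] nth[of "j - i"] len
      by (auto simp: hd_conv_nth last_conv_nth Suc_diff_le)
    ultimately have "graph_cycle H ?c"
      using len far that(3) gadj_sym[of H "p ! i" "p ! j"] by (auto simp: graph_cycle_def)
    then show False using H(2) by (auto simp: forest_def)
  qed
  have "graph_isomorphic (path_graph (length p)) ?I"
    unfolding graph_isomorphic_def
  proof (intro exI conjI ballI)
    show "bij_betw ((!) p) (gverts (path_graph (length p))) (gverts ?I)"
      using p'(3) \<open>set p = C\<close> by (simp add: path_graph_def vI bij_betw_nth)
    fix i j assume "i \<in> gverts (path_graph (length p))" "j \<in> gverts (path_graph (length p))"
    then have ij: "i < length p" "j < length p" by (auto simp: path_graph_def)
    then have C: "p ! i \<in> C" "p ! j \<in> C" using p'(2) by auto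
    have "gadj (path_graph (length p)) i j \<longleftrightarrow> j = Suc i \<or> i = Suc j"
      using ij by (auto simp: gadj_def path_graph_def doubleton_eq_iff)
    also have "\<dots> \<longleftrightarrow> gadj H (p ! i) (p ! j)"
    proof
      show "j = Suc i \<or> i = Suc j \<Longrightarrow> gadj H (p ! i) (p ! j)"
        using step ij gadj_sym by metis
      assume adj: "gadj H (p ! i) (p ! j)"
      then have "i \<noteq> j" using gadj_simple(3)[OF H(1)] by blast
      then show "j = Suc i \<or> i = Suc j"
        using chordless[of i j] chordless[of j i] ij adj gadj_sym[of H] by (metis le_antisym linorder_neqE_nat not_less_eq_eq order.strict_iff_not)
    qed
    finally show "gadj (path_graph (length p)) i j \<longleftrightarrow> gadj ?I (p ! i) (p ! j)"
      using aI C by simp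
  qed
  moreover have "1 \<le> length p" using p'(1) by (cases p) auto
  ultimately show ?thesis by blast
qed

text \<open>The sequence \<open>a\<close> runs periodically around a cycle. Two consecutive edges never lie in the same triangle,
  since their ends would be adjacent, and never both leave triangles, since a vertex has at most one
  outer neighbour. So inner and outer edges alternate, \<open>n\<close> is even, and every second step is a step in
  Walther's graph. The projected walk of period \<open>n div 2\<close> does not turn back on itself, and Walther's
  graph has no triangles or squares.\<close>

lemma truncated_closed_walk_length:
  fixes a :: "nat \<Rightarrow> nat"
  assumes edge: "\<And>i. gadj truncated_walther (a i) (a (Suc i))"
    and turn: "\<And>i. a i \<noteq> a (Suc (Suc i))" "\<And>i. \<not> gadj truncated_walther (a i) (a (Suc (Suc i)))"
    and period: "\<And>i. a (i + n) = a i" and "0 < n"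
  shows "10 \<le> n"
proof (rule ccontr)
  assume "\<not> 10 \<le> n"
  define b where "b i = a i div 3" for i
  define ext where "ext i \<longleftrightarrow> b i \<noteq> b (Suc i)" for i
  have alt: "ext (Suc i) \<longleftrightarrow> \<not> ext i" for i
  proof -
    have "\<not> (ext i \<and> ext (Suc i))"
      using truncated_cross_nbr_unique[of "a (Suc i)" "a i" "a (Suc (Suc i))"] edge[of i] edge[of "Suc i"]
        turn(1)[of i] gadj_sym[of truncated_walther "a i" "a (Suc i)"]
      unfolding ext_def b_def by metis
    moreover have "ext i \<or> ext (Suc i)"
      using edge[of i] edge[of "Suc i"] turn[of i]
      by (auto simp: ext_def b_def gadj_truncated tadj_def)
    ultimately show ?thesis by blast
  qed
  have parity: "ext (i + k) \<longleftrightarrow> (ext i \<longleftrightarrow> even k)" for i k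
    by (induction k) (auto simp: alt)
  have "ext (0 + n) \<longleftrightarrow> ext 0" using period[of 0] period[of 1] by (simp add: ext_def b_def)
  then have "even n" using parity[of 0 n] by blast
  obtain s where s: "ext s" using alt[of 0] by blast
  have e: "ext (s + k) \<longleftrightarrow> even k" for k using parity s by blast
  have stay: "b (s + Suc (2 * k)) = b (s + 2 * Suc k)" for k
    using e[of "Suc (2 * k)"] by (simp add: ext_def)
  have go: "gadj walther (b (s + 2 * k)) (b (s + 2 * Suc k))" for k
    using e[of "2 * k"] stay[of k] truncated_cross_edge(2)[OF edge[of "s + 2 * k"]]
    by (simp add: ext_def b_def)
  have no_return: "b (s + 2 * k) \<noteq> b (s + 2 * Suc (Suc k))" for k
  proof
    assume return: "b (s + 2 * k) = b (s + 2 * Suc (Suc k))"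
    have "a (s + Suc (2 * k)) = a (s + 2 * Suc k)"
    proof (rule truncated_cross_edge_unique)
      show "gadj truncated_walther (a (s + Suc (2 * k))) (a (s + 2 * k))"
        using edge[of "s + 2 * k"] gadj_sym[of truncated_walther "a (s + 2 * k)"] by simp
      show "gadj truncated_walther (a (s + 2 * Suc k)) (a (s + Suc (2 * Suc k)))"
        using edge[of "s + 2 * Suc k"] by simp
      show "a (s + Suc (2 * k)) div 3 \<noteq> a (s + 2 * k) div 3"
        using e[of "2 * k"] by (simp add: ext_def b_def)
      show "a (s + Suc (2 * k)) div 3 = a (s + 2 * Suc k) div 3"
        using stay[of k] unfolding b_def .
      show "a (s + 2 * k) div 3 = a (s + Suc (2 * Suc k)) div 3"
        using stay[of "Suc k"] return unfolding b_def by simp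
    qed
    then show False using edge[of "s + Suc (2 * k)"] by (simp add: gadj_truncated)
  qed
  have per: "b (s + n) = b s" using period by (simp add: b_def)
  \<comment> \<open>Starting from an outer edge, the vertices \<open>b s, b (s + 2), b (s + 4), \<dots>\<close> are the projected walk.\<close>
  have "n = 2 \<or> n = 4 \<or> n = 6 \<or> n = 8" using \<open>even n\<close> \<open>0 < n\<close> \<open>\<not> 10 \<le> n\<close> by presburger
  then show False
  proof (elim disjE)
    assume "n = 2"
    then show False using go[of 0] per by (simp add: gadj_walther nbrs_props(2))
  next
    assume "n = 4"
    then show False using no_return[of 0] per by simp
  next
    assume "n = 6"
    then show False
      using walther_triangle_free[of "b s" "b (s + 2)" "b (s + 4)"] go[of 0] go[of 1] go[of 2] per
        gadj_sym[of walther "b s"] by simp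
  next
    assume "n = 8"
    then show False
      using walther_square_free[of "b s" "b (s + 2)" "b (s + 4)" "b (s + 6)"]
        go[of 0] go[of 1] go[of 2] go[of 3] per no_return[of 0] no_return[of 1] by simp
  qed
qed

text \<open>Every cubic vertex whose neighbours all lie in \<open>S\<close> must itself be missing from \<open>S\<close>. But a single
  vertex and its neighbours account for at most four of the nine cubic vertices, so two missing
  vertices cannot spoil all nine.\<close>

lemma max_degree_2_in_walther:
  assumes "S \<subseteq> {..<12}"
    and deg: "\<And>x a b c. x \<in> S \<Longrightarrow> {a, b, c} \<subseteq> S \<Longrightarrow> gadj walther x a \<Longrightarrow> gadj walther x b \<Longrightarrow>
                gadj walther x c \<Longrightarrow> a = b \<or> a = c \<or> b = c"
  shows "card S \<le> 9"
proof (rule ccontr)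
  assume "\<not> ?thesis"
  then have "card ({..<12} - S) \<le> 2"
    using assms(1) by (subst card_Diff_subset) (auto intro: finite_subset)
  then obtain B where B: "{..<12} - S \<subseteq> B" "B \<subseteq> {..<12}" "card B = 2"
    using exists_subset_between[of "{..<12} - S" 2 "{..<12::nat}"] by auto
  then obtain a b where ab: "B = {a, b}" by (auto simp: card_2_iff)
  have "\<forall>a\<in>set [0..<12]. \<forall>b\<in>set [0..<12]. \<exists>w\<in>set [0..<9]. {a, b} \<inter> set (w # nbrs w) = {}"
    by code_simp
  moreover have "a \<in> set [0..<12]" "b \<in> set [0..<12]" using B(2) unfolding ab by simp_all
  ultimately obtain w where "w \<in> set [0..<9]" and w: "{a, b} \<inter> set (w # nbrs w) = {}" by blast
  then have w9: "w < 9" by simp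
  have "set (w # nbrs w) \<subseteq> {..<12}" using w9 nbrs_props(1)[of w] by auto
  then have wS: "set (w # nbrs w) \<subseteq> S" using w B(1) unfolding ab by blast
  have "length (nbrs w) = 3"
    using w9 by (auto simp: nbrs_def less_Suc_eq numeral_eq_Suc)
  then obtain x y z where "nbrs w = [x, y, z]"
    by (auto simp: length_Suc_conv numeral_3_eq_3)
  moreover have "distinct (nbrs w)" using w9 by (intro distinct_nbrs) simp
  ultimately show False using wS deg[of w x y z] w9 by (auto simp: gadj_walther)
qed

theorem proposition1:
  fixes H :: "'a sgraph"
  assumes "simple_graph H" and "fixer H"
  shows "linear_forest H \<and> card (gverts H) \<le> 9"
proof -
  note V = gadj_simple[OF assms(1)]
  obtain f where f: "inj_on f (gverts H)" "f ` gverts H \<subseteq> {..<12}"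
    and fadj: "\<And>u v. u \<in> gverts H \<Longrightarrow> v \<in> gverts H \<Longrightarrow> gadj H u v \<longleftrightarrow> gadj walther (f u) (f v)"
    using fixer_embeds[OF assms(2) _ walther_connected walther_no_gallai_vertex]
    by (metis gverts_walther simple_graph_on walther_def)
  obtain g where g: "inj_on g (gverts H)" "g ` gverts H \<subseteq> {..<36}"
    and gadj: "\<And>u v. u \<in> gverts H \<Longrightarrow> v \<in> gverts H \<Longrightarrow> gadj H u v \<longleftrightarrow> gadj truncated_walther (g u) (g v)"
    using fixer_embeds[OF assms(2) _ truncated_connected truncated_no_gallai_vertex]
    by (metis gverts_truncated simple_graph_on truncated_walther_def)
  have triangle_free: "\<not> gadj H u w" if "gadj H u v" "gadj H v w" for u v w
    using that V fadj walther_triangle_free by metis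
  have deg: "a = b \<or> a = c \<or> b = c" if adj: "gadj H x a" "gadj H x b" "gadj H x c" for x a b c
  proof (rule ccontr)
    assume "\<not> ?thesis"
    then have "g a \<noteq> g b" "g a \<noteq> g c" "g b \<noteq> g c"
      using g(1) V(2)[OF adj(1)] V(2)[OF adj(2)] V(2)[OF adj(3)] by (auto dest: inj_onD)
    moreover have "gadj truncated_walther (g x) (g a)" "gadj truncated_walther (g x) (g b)"
      "gadj truncated_walther (g x) (g c)" using adj V(1,2) gadj by blast+
    ultimately have "gadj H a b \<or> gadj H a c \<or> gadj H b c"
      using truncated_claw_free V(2)[OF adj(1)] V(2)[OF adj(2)] V(2)[OF adj(3)] gadj by metis
    then show False using triangle_free adj gadj_sym by metis
  qed
  have card_le: "card (gverts H) \<le> 9"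
  proof -
    have "card (f ` gverts H) \<le> 9"
    proof (rule max_degree_2_in_walther[OF f(2)])
      fix x a b c
      assume "x \<in> f ` gverts H" "{a, b, c} \<subseteq> f ` gverts H"
        "gadj walther x a" "gadj walther x b" "gadj walther x c"
      then show "a = b \<or> a = c \<or> b = c" using deg fadj by (auto, metis)
    qed
    then show ?thesis using card_image[OF f(1)] by simp
  qed
  have forest: "forest H"
    unfolding forest_def
  proof
    assume "\<exists>cs. graph_cycle H cs"
    then obtain cs where cs: "distinct cs" "set cs \<subseteq> gverts H" "successively (gadj H) cs" "cs \<noteq> []"
      "3 \<le> length cs" "gadj H (last cs) (hd cs)"
      by (auto simp: graph_cycle_def graph_path_def)
    define n where "n = length cs"
    have n: "3 \<le> n" using cs n_def by simp
    \<comment> \<open>The cycle as a periodic sequence, so that neighbouring positions need no wrap-around case.\<close>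
    define c where "c i = cs ! (i mod n)" for i
    have cV: "c i \<in> gverts H" for i
    proof -
      have "i mod n < length cs" using n unfolding n_def[symmetric] by simp
      then show ?thesis using cs(2) nth_mem unfolding c_def by blast
    qed
    have cedge: "gadj H (c i) (c (Suc i))" for i
    proof (cases "Suc (i mod n) = n")
      case True
      then have "i mod n = n - 1" "Suc i mod n = 0" by (auto simp: mod_Suc)
      moreover have "last cs = cs ! (n - 1)" "hd cs = cs ! 0"
        using cs(4) unfolding n_def by (rule last_conv_nth, rule hd_conv_nth)
      ultimately have "c i = last cs" "c (Suc i) = hd cs" unfolding c_def by metis+
      then show ?thesis using cs(6) by simp
    next
      case False
      then have "Suc i mod n = Suc (i mod n)" "Suc (i mod n) < n"
        using n by (auto simp: mod_Suc intro: Suc_lessI)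
      then show ?thesis using cs(3) by (simp add: c_def n_def successively_conv_nth)
    qed
    have cturn: "c i \<noteq> c (Suc (Suc i))" for i
    proof
      assume "c i = c (Suc (Suc i))"
      moreover have "i mod n < length cs" "Suc (Suc i) mod n < length cs"
        using n unfolding n_def[symmetric] by simp_all
      ultimately have same: "i mod n = Suc (Suc i) mod n"
        using cs(1) nth_eq_iff_index_eq unfolding c_def by blast
      define m where "m = i mod n"
      have "m < n" using n by (simp add: m_def)
      have "Suc (Suc i) mod n = (m + 2) mod n" unfolding m_def by (simp add: mod_simps)
      then have m2: "(m + 2) mod n = m" using same m_def by metis
      show False
      proof (cases "m + 2 < n")
        case True
        then show False using m2 by simp
      next
        case False
        then have "(m + 2) mod n = m + 2 - n" using \<open>m < n\<close> n by (subst le_mod_geq) auto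
        then show False using m2 n False by linarith
      qed
    qed
    have "10 \<le> n"
    proof (rule truncated_closed_walk_length[where a = "\<lambda>i. g (c i)"])
      show "gadj truncated_walther (g (c i)) (g (c (Suc i)))" for i
        using cedge gadj cV by blast
      show "g (c i) \<noteq> g (c (Suc (Suc i)))" for i
        using cturn g(1) cV by (auto dest: inj_onD)
      show "\<not> gadj truncated_walther (g (c i)) (g (c (Suc (Suc i))))" for i
        using triangle_free[OF cedge cedge] gadj cV by blast
      show "g (c (i + n)) = g (c i)" for i by (simp add: c_def)
      show "0 < n" using n by simp
    qed
    moreover have "n \<le> card (gverts H)"
      using cs(1,2) assms(1) card_mono distinct_card unfolding n_def simple_graph_def by metis
    ultimately show False using card_le by simp
  qed
  show ?thesis
    using component_path[OF assms(1) forest _ deg] forest card_le by (auto simp: linear_forest_def)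
qed

end
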